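(* Let $\mathcal{A}$ be a subset of $\mathcal{P}^{(1)}$. If $\mathcal{A}$ has a Friedberg numbering, and $\mathcal{A}$ is strongly dense in itself, then there exists a uniformly c.e. independent sequence $\{\nu_i\}_{i\in\mathbb{N}}$ of Friedberg numberings of $\mathcal{A}$.
   Context: $\mathcal{P}^{(1)}$ denotes the set of all partial computable functions from $\mathbb{N}$ to $\mathbb{N}$, and $\langle\cdot,\cdot\rangle$ is a fixed computable bijection from $\mathbb{N}^2$ to $\mathbb{N}$. A numbering of a set $\mathcal{A}$ is a surjective map $\nu\colon\mathbb{N}\to\mathcal{A}$. A numbering $\nu$ is reducible to a numbering $\mu$, written $\nu\leq\mu$, if there is a total computable function $f\colon\mathbb{N}\to\mathbb{N}$ with $\nu=\mu\circ f$. A numbering $\nu$ of a subset of $\mathcal{P}^{(1)}$ is computable if the partial function $(i,x)\mapsto\nu(i)(x)$ from $\mathbb{N}^2$ to $\mathbb{N}$ is partial computable. A Friedberg numbering is an injective computable numbering. A sequence $\{\nu_i\}_{i\in\mathbb{N}}$ of numberings of a subset of $\mathcal{P}^{(1)}$ is uniformly c.e. if the partial function $(i,n,x)\mapsto\nu_i(n)(x)$ from $\mathbb{N}^3$ to $\mathbb{N}$ is partial computable. The direct sum of a sequence $\{\mu_j\}_{j\in\mathbb{N}}$ of numberings of a set $\mathcal{A}$ is the numbering $\bigoplus_{j\in\mathbb{N}}\mu_j$ of $\mathcal{A}$ given by $\bigl(\bigoplus_{j\in\mathbb{N}}\mu_j\bigr)(\langle j,k\rangle)=\mu_j(k)$;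 the notation $\bigoplus_{j\neq i}\nu_j$ means the direct sum of the sequence $\nu_0,\ldots,\nu_{i-1},\nu_{i+1},\nu_{i+2},\ldots$ obtained by omitting $\nu_i$ and reindexing by $\mathbb{N}$ in increasing order. A sequence $\{\nu_i\}_{i\in\mathbb{N}}$ of numberings of a set is independent if $\nu_i\nleq\bigoplus_{j\neq i}\nu_j$ for all $i\in\mathbb{N}$. For $\mathcal{X},\mathcal{Y}\subseteq\mathcal{P}^{(1)}$, $\mathcal{Y}$ is strongly dense in $\mathcal{X}$ if every finite subfunction (restriction to a finite domain) of a member of $\mathcal{X}$ has infinitely many extensions in $\mathcal{Y}$; $\mathcal{A}$ is strongly dense in itself if this holds with $\mathcal{X}=\mathcal{Y}=\mathcal{A}$. *)

theory Defs
  imports Main "HOL-Library.Nat_Bijection"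
begin

text \<open>
  Partial computable functions are the Kleene partial recursive (\<open>\<mu>\<close>-recursive) functions.
  Terms carry no arity; a term is applied to the list of its arguments, and a term applied to
  a list of unsuitable length is undefined. So for each fixed \<open>k\<close>, every term denotes on lists
  of length \<open>k\<close> a \<open>k\<close>-ary partial recursive function (possibly the nowhere defined one).
\<close>

datatype recf =
    Zero
  | Succ
  | Proj nat
  | Comp recf "recf list"
  | PrimRec recf recf
  | Mu recf

text \<open>
  In \<open>PrimRec f g\<close> and \<open>Mu f\<close> the recursion variable, respectively the search variable, is
  the first argument. Composition is strict, and \<open>Mu\<close> requires \<open>f\<close> to be defined at all
  arguments below the zero that is returned.
\<close>

fun sem :: "recf \<Rightarrow> nat list \<Rightarrow> nat option" where
  "sem Zero xs = Some 0"
| "sem Succ xs = (case xs of [x] \<Rightarrow> Some (Suc x) | _ \<Rightarrow> None)"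
| "sem (Proj i) xs = (if i < length xs then Some (xs ! i) else None)"
| "sem (Comp f gs) xs =
     (if \<forall>g \<in> set gs. sem g xs \<noteq> None
      then sem f (map (\<lambda>g. the (sem g xs)) gs) else None)"
| "sem (PrimRec f g) xs =
     (case xs of
        [] \<Rightarrow> None
      | n # ys \<Rightarrow>
          rec_nat (sem f ys)
            (\<lambda>m r. case r of None \<Rightarrow> None | Some v \<Rightarrow> sem g (m # v # ys)) n)"
| "sem (Mu f) xs =
     (if \<exists>n. sem f (n # xs) = Some 0 \<and> (\<forall>m<n. sem f (m # xs) \<noteq> None)
      then Some (LEAST n. sem f (n # xs) = Some 0) else None)"

definition partial_computable1 :: "(nat \<Rightarrow> nat option) \<Rightarrow> bool" where
  "partial_computable1 f \<longleftrightarrow> (\<exists>p. \<forall>x. sem p [x] = f x)"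

definition partial_computable2 :: "(nat \<Rightarrow> nat \<Rightarrow> nat option) \<Rightarrow> bool" where
  "partial_computable2 f \<longleftrightarrow> (\<exists>p. \<forall>x y. sem p [x, y] = f x y)"

definition partial_computable3 :: "(nat \<Rightarrow> nat \<Rightarrow> nat \<Rightarrow> nat option) \<Rightarrow> bool" where
  "partial_computable3 f \<longleftrightarrow> (\<exists>p. \<forall>x y z. sem p [x, y, z] = f x y z)"

definition total_computable :: "(nat \<Rightarrow> nat) \<Rightarrow> bool" where
  "total_computable f \<longleftrightarrow> partial_computable1 (\<lambda>x. Some (f x))"

definition P1 :: "(nat \<rightharpoonup> nat) set" where
  "P1 = {f. partial_computable1 f}"

definition numbering :: "(nat \<Rightarrow> 'a) \<Rightarrow> 'a set \<Rightarrow> bool" where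
  "numbering \<nu> A \<longleftrightarrow> range \<nu> = A"

definition reducible :: "(nat \<Rightarrow> 'a) \<Rightarrow> (nat \<Rightarrow> 'a) \<Rightarrow> bool" where
  "reducible \<nu> \<mu> \<longleftrightarrow> (\<exists>f. total_computable f \<and> \<nu> = \<mu> \<circ> f)"

definition computable_numbering :: "(nat \<Rightarrow> nat \<rightharpoonup> nat) \<Rightarrow> (nat \<rightharpoonup> nat) set \<Rightarrow> bool" where
  "computable_numbering \<nu> A \<longleftrightarrow> numbering \<nu> A \<and> partial_computable2 \<nu>"

definition friedberg_numbering :: "(nat \<Rightarrow> nat \<rightharpoonup> nat) \<Rightarrow> (nat \<rightharpoonup> nat) set \<Rightarrow> bool" where
  "friedberg_numbering \<nu> A \<longleftrightarrow> computable_numbering \<nu> A \<and> inj \<nu>"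

definition uniformly_ce :: "(nat \<Rightarrow> nat \<Rightarrow> nat \<rightharpoonup> nat) \<Rightarrow> bool" where
  "uniformly_ce \<nu> \<longleftrightarrow> partial_computable3 \<nu>"

text \<open>The fixed computable pairing is the Cantor pairing \<open>prod_encode\<close>, with inverse \<open>prod_decode\<close>.\<close>

definition direct_sum :: "(nat \<Rightarrow> nat \<Rightarrow> 'a) \<Rightarrow> nat \<Rightarrow> 'a" where
  "direct_sum \<mu> n = (case prod_decode n of (j, k) \<Rightarrow> \<mu> j k)"

definition omit :: "nat \<Rightarrow> (nat \<Rightarrow> 'b) \<Rightarrow> nat \<Rightarrow> 'b" where
  "omit i \<nu> j = (if j < i then \<nu> j else \<nu> (Suc j))"

definition independent_numberings :: "(nat \<Rightarrow> nat \<Rightarrow> 'a) \<Rightarrow> bool" where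
  "independent_numberings \<nu> \<longleftrightarrow> (\<forall>i. \<not> reducible (\<nu> i) (direct_sum (omit i \<nu>)))"

definition strongly_dense_in :: "(nat \<rightharpoonup> nat) set \<Rightarrow> (nat \<rightharpoonup> nat) set \<Rightarrow> bool" where
  "strongly_dense_in Y X \<longleftrightarrow>
     (\<forall>f \<in> X. \<forall>\<sigma>. finite (dom \<sigma>) \<and> \<sigma> \<subseteq>\<^sub>m f \<longrightarrow> infinite {g \<in> Y. \<sigma> \<subseteq>\<^sub>m g})"

end

theory Submission
  imports Defs "HOL-Library.Infinite_Set"
begin

text \<open>
  Let \<open>\<mu>\<close> be a Friedberg numbering of \<open>A\<close>. Each numbering of the sequence is a rearrangement
  \<open>\<nu> i = \<mu> \<circ> perm i\<close>, where \<open>perm i\<close> is an involution of the natural numbers that is only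
  computable in the limit; so every \<open>\<nu> i\<close> is automatically an injective numbering of \<open>A\<close>, and
  what needs care is that it is computable.

  Write \<open>\<phi> e\<close> for the partial computable function with code \<open>e\<close>. For every pair \<open>(i, e)\<close> a
  construction in stages reserves a witness \<open>w\<close> and waits for \<open>\<phi> e w\<close> to converge. If this
  happens, by stage \<open>s\<close> say, the values of \<open>\<mu> w\<close> computed so far form a finite subfunction of a
  member of \<open>A\<close>. As \<open>A\<close> is strongly dense in itself and \<open>\<mu>\<close> is onto \<open>A\<close>, there are arbitrarily
  large \<open>q\<close> such that \<open>\<mu> q\<close> extends this finite function. A target \<open>q\<close> of this kind that exceeds
  everything mentioned before is found by search, and \<open>perm i\<close> swaps \<open>w\<close> and \<open>q\<close>. The target is
  so large that no value of \<open>\<nu> i q\<close> has been announced yet, and the announced values of \<open>\<nu> i w\<close>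
  remain correct; this makes \<open>\<nu>\<close> uniformly computable (\<open>late_swap_extends\<close>). No reservation is
  ever injured: witnesses and targets are all distinct, over all \<open>i\<close> and \<open>e\<close> (\<open>entry_inj\<close>).

  Suppose that \<open>\<phi> e\<close> is total and reduces \<open>\<nu> i\<close> to the direct sum of the other numberings, and
  that \<open>\<phi> e w = \<langle>j, m\<rangle>\<close> refers to the number \<open>m\<close> of \<open>\<nu> j'\<close>, \<open>j' \<noteq> i\<close>. Then
  \<open>\<mu> q = \<nu> i w = \<nu> j' m\<close>, hence \<open>perm j' m = q\<close>. But \<open>q\<close> belongs to the pair \<open>(i, e)\<close> only, so it
  is a fixed point of \<open>perm j'\<close>, and \<open>m = q\<close>. This is impossible, because the target was chosen
  above the value \<open>\<phi> e w\<close>, and so above \<open>m\<close>.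

  To carry out the construction inside the given model of computation, total computable
  functions and decidable predicates on codes of tuples and of finite sets are shown to be
  closed under the usual operations. Universal evaluation is obtained by enumerating the finite
  sets \<open>facts t\<close> of true statements ``the term with code \<open>c\<close> has value \<open>y\<close> at \<open>xs\<close>'' with a
  primitive recursion on \<open>t\<close> (\<open>facts_iff_sem\<close>).
\<close>

section \<open>Programs for the Cantor pairing\<close>

abbreviation pair :: "nat \<Rightarrow> nat \<Rightarrow> nat" where
  "pair a b \<equiv> prod_encode (a, b)"

abbreviation left :: "nat \<Rightarrow> nat" where
  "left z \<equiv> fst (prod_decode z)"

abbreviation right :: "nat \<Rightarrow> nat" where
  "right z \<equiv> snd (prod_decode z)"

lemma right_le: "right z \<le> z"
  by (metis le_prod_encode_2 prod.collapse prod_decode_inverse)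

lemma pair_left_right [simp]: "pair (left z) (right z) = z"
  by simp

definition add_recf :: recf where
  "add_recf = PrimRec (Proj 0) (Comp Succ [Proj 1])"

lemma sem_add_recf [simp]: "sem add_recf [a, b] = Some (a + b)"
  by (induction a) (auto simp: add_recf_def)

definition pred_recf :: recf where
  "pred_recf = PrimRec Zero (Proj 0)"

lemma sem_pred_recf [simp]: "sem pred_recf [a] = Some (a - 1)"
proof -
  have "rec_nat (Some 0) (\<lambda>m r. case r of None \<Rightarrow> None | Some v \<Rightarrow> Some m) a = Some (a - 1)"
    by (induction a) auto
  then show ?thesis by (simp add: pred_recf_def)
qed

definition diff_recf :: recf where
  "diff_recf = PrimRec (Proj 0) (Comp pred_recf [Proj 1])"

lemma sem_diff_recf [simp]: "sem diff_recf [b, a] = Some (a - b)"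
  by (induction b) (auto simp: diff_recf_def)

definition triangle_recf :: recf where
  "triangle_recf = PrimRec Zero (Comp Succ [Comp add_recf [Proj 0, Proj 1]])"

lemma sem_triangle_recf [simp]: "sem triangle_recf [n] = Some (triangle n)"
  by (induction n) (auto simp: triangle_recf_def)

definition pair_recf :: recf where
  "pair_recf = Comp add_recf [Comp triangle_recf [add_recf], Proj 0]"

lemma sem_pair_recf [simp]: "sem pair_recf [a, b] = Some (pair a b)"
  by (simp add: pair_recf_def prod_encode_def)

text \<open>
  The code \<open>z\<close> of \<open>(a, b)\<close> lies between \<open>triangle (a + b)\<close> and \<open>triangle (Suc (a + b))\<close>. The
  search for the least \<open>k\<close> with \<open>z < triangle (Suc k)\<close> therefore returns the number \<open>a + b\<close> of the
  diagonal; both components of the pair follow from it by subtraction.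
\<close>

definition diagonal_recf :: recf where
  "diagonal_recf =
     Mu (Comp diff_recf [Comp triangle_recf [Comp Succ [Proj 0]], Comp Succ [Proj 1]])"

lemma sem_diagonal_recf [simp]: "sem diagonal_recf [pair a b] = Some (a + b)"
proof -
  have mono: "triangle m \<le> triangle n" if "m \<le> n" for m n
    using that by (induction rule: dec_induct) auto
  have iff: "Suc (pair a b) - triangle (Suc k) = 0 \<longleftrightarrow> a + b \<le> k" for k
  proof
    assume "Suc (pair a b) - triangle (Suc k) = 0"
    then have "\<not> Suc k \<le> a + b"
      using mono[of "Suc k" "a + b"] by (auto simp: prod_encode_def)
    then show "a + b \<le> k" by simp
  next
    assume "a + b \<le> k"
    then show "Suc (pair a b) - triangle (Suc k) = 0"
      using mono[of "Suc (a + b)" "Suc k"] by (simp add: prod_encode_def)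
  qed
  have "(LEAST n. a + b \<le> n) = a + b"
    by (rule Least_equality) auto
  then show ?thesis
    using iff by (auto simp: diagonal_recf_def simp del: triangle_Suc)
qed

definition left_recf :: recf where
  "left_recf = Comp diff_recf [Comp triangle_recf [diagonal_recf], Proj 0]"

lemma sem_left_recf [simp]: "sem left_recf [z] = Some (left z)"
proof -
  have "sem left_recf [pair a b] = Some a" for a b
    by (simp add: left_recf_def) (simp add: prod_encode_def)
  from this[of "left z" "right z"] show ?thesis by simp
qed

definition right_recf :: recf where
  "right_recf = Comp diff_recf [left_recf, diagonal_recf]"

lemma sem_right_recf [simp]: "sem right_recf [z] = Some (right z)"
proof -
  have "sem right_recf [pair a b] = Some b" for a b
    by (simp add: right_recf_def)
  from this[of "left z" "right z"] show ?thesis by simp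
qed

section \<open>Total computable functions and decidable predicates\<close>

text \<open>
  All functions are unary: an environment of several variables is packed into one number with the
  pairing function. The premises of rules for binders (recursion, bounded quantification, search)
  read the bound variables back with \<open>left\<close> and \<open>right\<close>, so that the rules can be applied by
  resolution and compose to proofs of computability that follow the shape of a term.
\<close>

named_theorems computability

lemma total_computableI: "(\<And>x. sem p [x] = Some (f x)) \<Longrightarrow> total_computable f"
  by (auto simp: total_computable_def partial_computable1_def)

lemma total_computableE:
  assumes "total_computable f"
  obtains p where "\<And>x. sem p [x] = Some (f x)"
  using assms by (auto simp: total_computable_def partial_computable1_def)

lemma total_computable_id [computability]: "total_computable (\<lambda>x. x)"
  by (rule total_computableI[of "Proj 0"]) simp

lemma total_computable_Suc [computability]:
  assumes "total_computable f"
  shows "total_computable (\<lambda>x. Suc (f x))"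
proof -
  from assms obtain p where "\<And>x. sem p [x] = Some (f x)" by (meson total_computableE)
  then show ?thesis by (intro total_computableI[of "Comp Succ [p]"]) simp
qed

lemma total_computable_const [computability]: "total_computable (\<lambda>x. c)"
proof (induction c)
  case 0
  show ?case by (rule total_computableI[of Zero]) simp
next
  case (Suc c)
  then show ?case by (rule total_computable_Suc)
qed

lemma total_computable_pair [computability]:
  assumes "total_computable f" "total_computable g"
  shows "total_computable (\<lambda>x. pair (f x) (g x))"
proof -
  from assms obtain p q where "\<And>x. sem p [x] = Some (f x)" "\<And>x. sem q [x] = Some (g x)"
    by (meson total_computableE)
  then show ?thesis by (intro total_computableI[of "Comp pair_recf [p, q]"]) simp
qed

lemma total_computable_comp:
  assumes "total_computable g" "total_computable f"
  shows "total_computable (\<lambda>x. g (f x))"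
proof -
  from assms obtain p q where "\<And>x. sem p [x] = Some (f x)" "\<And>x. sem q [x] = Some (g x)"
    by (meson total_computableE)
  then show ?thesis by (intro total_computableI[of "Comp q [p]"]) simp
qed

lemma total_computable_left [computability]:
  "total_computable f \<Longrightarrow> total_computable (\<lambda>x. left (f x))"
  by (rule total_computable_comp[OF total_computableI[of left_recf]]) simp_all

lemma total_computable_right [computability]:
  "total_computable f \<Longrightarrow> total_computable (\<lambda>x. right (f x))"
  by (rule total_computable_comp[OF total_computableI[of right_recf]]) simp_all

lemma total_computable_rec [computability]:
  assumes f: "total_computable f"
    and g: "total_computable (\<lambda>z. g (left z) (left (right z)) (right (right z)))"
    and h: "total_computable h"
  shows "total_computable (\<lambda>x. rec_nat (f x) (g x) (h x))"
proof -
  obtain p where p: "\<And>x. sem p [x] = Some (f x)" using f by (meson total_computableE)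
  obtain q where q: "\<And>z. sem q [z] = Some (g (left z) (left (right z)) (right (right z)))"
    using g by (meson total_computableE)
  obtain r where r: "\<And>x. sem r [x] = Some (h x)" using h by (meson total_computableE)
  define q' where "q' = Comp q [Comp pair_recf [Proj 2, Comp pair_recf [Proj 0, Proj 1]]]"
  have q': "sem q' [m, v, x] = Some (g x m v)" for m v x
    by (simp add: q'_def q)
  have "sem (PrimRec p q') [n, x] = Some (rec_nat (f x) (g x) n)" for n x
    by (induction n) (auto simp: p q')
  then show ?thesis
    by (intro total_computableI[of "Comp (PrimRec p q') [r, Proj 0]"]) (simp add: r del: sem.simps(5))
qed

lemma total_computable_add [computability]:
  assumes "total_computable f" "total_computable g"
  shows "total_computable (\<lambda>x. f x + g x)"
proof -
  from assms obtain p q where "\<And>x. sem p [x] = Some (f x)" "\<And>x. sem q [x] = Some (g x)"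
    by (meson total_computableE)
  then show ?thesis by (intro total_computableI[of "Comp add_recf [p, q]"]) simp
qed

lemma total_computable_diff [computability]:
  assumes "total_computable f" "total_computable g"
  shows "total_computable (\<lambda>x. f x - g x)"
proof -
  from assms obtain p q where "\<And>x. sem p [x] = Some (f x)" "\<And>x. sem q [x] = Some (g x)"
    by (meson total_computableE)
  then show ?thesis by (intro total_computableI[of "Comp diff_recf [q, p]"]) simp
qed

lemma total_computable_mult [computability]:
  assumes "total_computable f" "total_computable g"
  shows "total_computable (\<lambda>x. f x * g x)"
proof -
  have eq: "a * b = rec_nat 0 (\<lambda>_ v. v + b) a" for a b :: nat
    by (induction a) auto
  show ?thesis
    unfolding eq by (intro computability assms total_computable_comp[OF assms(2)])
qed

lemma total_computable_power2 [computability]: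
  assumes "total_computable f"
  shows "total_computable (\<lambda>x. 2 ^ f x)"
proof -
  have eq: "(2::nat) ^ a = rec_nat 1 (\<lambda>_ v. v + v) a" for a
    by (induction a) auto
  show ?thesis
    unfolding eq by (intro computability assms)
qed

definition decidable :: "(nat \<Rightarrow> bool) \<Rightarrow> bool" where
  "decidable P \<longleftrightarrow> total_computable (\<lambda>x. of_bool (P x))"

lemma decidable_comp: "decidable P \<Longrightarrow> total_computable f \<Longrightarrow> decidable (\<lambda>x. P (f x))"
  unfolding decidable_def by (rule total_computable_comp)

text \<open>
  Both branches are total, so evaluating both and selecting by multiplication is harmless.
\<close>

lemma total_computable_if [computability]:
  assumes "decidable P" "total_computable f" "total_computable g"
  shows "total_computable (\<lambda>x. if P x then f x else g x)"
proof -
  have eq: "(if P x then f x else g x) = of_bool (P x) * f x + (1 - of_bool (P x)) * g x" for x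
    by simp
  show ?thesis
    unfolding eq by (intro computability assms assms(1)[unfolded decidable_def])
qed

lemma decidable_not [computability]:
  assumes "decidable P" shows "decidable (\<lambda>x. \<not> P x)"
proof -
  have eq: "of_bool (\<not> b) = 1 - (of_bool b :: nat)" for b by simp
  show ?thesis
    using assms unfolding decidable_def eq by (intro computability)
qed

lemma decidable_conj [computability]:
  assumes "decidable P" "decidable Q" shows "decidable (\<lambda>x. P x \<and> Q x)"
  using assms unfolding decidable_def of_bool_conj by (intro computability)

lemma decidable_disj [computability]:
  assumes "decidable P" "decidable Q" shows "decidable (\<lambda>x. P x \<or> Q x)"
proof -
  have "decidable (\<lambda>x. \<not> (\<not> P x \<and> \<not> Q x))" by (intro computability assms)
  then show ?thesis by simp
qed

lemma decidable_imp [computability]: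
  assumes "decidable P" "decidable Q" shows "decidable (\<lambda>x. P x \<longrightarrow> Q x)"
proof -
  have "decidable (\<lambda>x. \<not> P x \<or> Q x)" by (intro computability assms)
  then show ?thesis by (simp only: imp_conv_disj)
qed

lemma decidable_if [computability]:
  assumes "decidable P" "decidable Q" "decidable R"
  shows "decidable (\<lambda>x. if P x then Q x else R x)"
proof -
  have "decidable (\<lambda>x. (P x \<longrightarrow> Q x) \<and> (\<not> P x \<longrightarrow> R x))"
    by (intro computability assms)
  then show ?thesis by (simp only: if_bool_eq_conj)
qed

lemma decidable_le [computability]:
  assumes "total_computable f" "total_computable g" shows "decidable (\<lambda>x. f x \<le> g x)"
proof -
  have eq: "of_bool (a \<le> b) = 1 - (a - b)" for a b :: nat by simp
  show ?thesis unfolding decidable_def eq by (intro computability assms)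
qed

lemma decidable_less [computability]:
  assumes "total_computable f" "total_computable g" shows "decidable (\<lambda>x. f x < g x)"
  unfolding less_eq_Suc_le by (intro computability assms)

lemma decidable_eq [computability]:
  fixes f g :: "nat \<Rightarrow> nat"
  assumes "total_computable f" "total_computable g" shows "decidable (\<lambda>x. f x = g x)"
  unfolding order_eq_iff by (intro computability assms)

lemma decidable_bex_less [computability]:
  assumes b: "total_computable b" and P: "decidable (\<lambda>z. P (left z) (right z))"
  shows "decidable (\<lambda>x. \<exists>n<b x. P x n)"
proof -
  have eq: "of_bool (\<exists>n<k. P x n) = rec_nat 0 (\<lambda>m v. if P x m then Suc 0 else v) k" for x k
  proof (induction k)
    case (Suc k)
    have "(\<exists>n<Suc k. P x n) \<longleftrightarrow> P x k \<or> (\<exists>n<k. P x n)"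
      by (rule Ex_less_Suc)
    with Suc show ?case by (cases "P x k") simp_all
  qed simp
  have "total_computable (\<lambda>z. pair (left z) (left (right z)))"
    by (intro computability)
  from decidable_comp[OF P this] have P': "decidable (\<lambda>z. P (left z) (left (right z)))"
    by simp
  show ?thesis
    unfolding decidable_def eq by (intro computability b P')
qed

lemma decidable_ball_less [computability]:
  assumes b: "total_computable b" and P: "decidable (\<lambda>z. P (left z) (right z))"
  shows "decidable (\<lambda>x. \<forall>n<b x. P x n)"
proof -
  have "decidable (\<lambda>x. \<not> (\<exists>n<b x. \<not> P x n))" by (intro computability assms)
  then show ?thesis by simp
qed

text \<open>
  Searches that may fail serve the evaluation of the rearranged numberings, where divergence is
  intended; \<open>total_computable_Least\<close> covers those that are known to succeed.
\<close>

lemma partial_Least: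
  assumes P: "decidable (\<lambda>z. P (left z) (right z))"
  obtains p where "\<And>x. sem p [x] = (if \<exists>t. P x t then Some (LEAST t. P x t) else None)"
proof -
  have "total_computable (\<lambda>z. 1 - of_bool (P (left z) (right z)))"
    using P by (intro computability) (simp add: decidable_def)
  then obtain q where q: "\<And>z. sem q [z] = Some (1 - of_bool (P (left z) (right z)))"
    using total_computableE by blast
  define p where "p = Mu (Comp q [Comp pair_recf [Proj 1, Proj 0]])"
  have "sem p [x] = (if \<exists>t. P x t then Some (LEAST t. P x t) else None)" for x
    by (simp add: p_def q)
  then show thesis by (rule that)
qed

lemma total_computable_Least [computability]:
  assumes P: "decidable (\<lambda>z. P (left z) (right z))" and ex: "\<And>x. \<exists>t. P x t"
  shows "total_computable (\<lambda>x. LEAST t. P x t)"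
proof -
  obtain p where "\<And>x. sem p [x] = (if \<exists>t. P x t then Some (LEAST t. P x t) else None)"
    using partial_Least[OF P] by blast
  then show ?thesis using ex by (intro total_computableI[of p]) simp
qed

lemma total_computable_div:
  assumes "total_computable f" "total_computable g" "\<And>x. 0 < g x"
  shows "total_computable (\<lambda>x. f x div g x)"
proof -
  have eq: "f x div g x = (LEAST u. f x < g x * Suc u)" for x
  proof (rule Least_equality[symmetric])
    show "f x < g x * Suc (f x div g x)"
      using dividend_less_times_div[OF assms(3)] by simp
    show "f x div g x \<le> u" if "f x < g x * Suc u" for u
      using that less_mult_imp_div_less[of "f x" "Suc u" "g x"] by (simp add: mult.commute)
  qed
  have "\<exists>u. f x < g x * Suc u" for x
    using dividend_less_times_div[OF assms(3)] by (metis mult_Suc_right)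
  then show ?thesis
    unfolding eq by (intro computability assms total_computable_comp[OF assms(1)] total_computable_comp[OF assms(2)])
qed

lemma decidable_mem [computability]:
  assumes "total_computable f" "total_computable g"
  shows "decidable (\<lambda>x. f x \<in> set_decode (g x))"
proof -
  have "decidable (\<lambda>x. \<not> g x div 2 ^ f x = 2 * (g x div 2 ^ f x div 2))"
    by (intro computability assms total_computable_div) auto
  moreover have "f x \<in> set_decode (g x) \<longleftrightarrow> \<not> g x div 2 ^ f x = 2 * (g x div 2 ^ f x div 2)" for x
    unfolding set_decode_def by simp (metis dvd_mult_div_cancel dvd_triv_left)
  ultimately show ?thesis by simp
qed

text \<open>
  Finite sets are represented by \<open>set_encode\<close>. The code of a finite set exceeds its elements; this
  turns quantification over the set into bounded quantification, and it makes the code itself a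
  convenient strict upper bound of all numbers that occur in the set.
\<close>

lemma mem_set_decode_less: "z \<in> set_decode k \<Longrightarrow> z < k"
proof -
  assume "z \<in> set_decode k"
  then have "2 ^ z \<le> k"
    by (auto simp: set_decode_def intro: ccontr)
  then show "z < k" using less_exp[of z] by linarith
qed

lemma decidable_bex_set [computability]:
  assumes k: "total_computable k" and P: "decidable (\<lambda>z. P (left z) (right z))"
  shows "decidable (\<lambda>x. \<exists>u\<in>set_decode (k x). P x u)"
proof -
  have "(\<exists>u\<in>set_decode (k x). P x u) \<longleftrightarrow> (\<exists>u<k x. u \<in> set_decode (k x) \<and> P x u)" for x
    using mem_set_decode_less by blast
  then show ?thesis
    by (simp only:) (intro computability assms total_computable_comp[OF k])
qed

definition set_insert :: "nat \<Rightarrow> nat \<Rightarrow> nat" where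
  "set_insert z k = (if z \<in> set_decode k then k else k + 2 ^ z)"

lemma set_decode_set_insert [simp]: "set_decode (set_insert z k) = insert z (set_decode k)"
proof (cases "z \<in> set_decode k")
  case False
  then have "set_encode (insert z (set_decode k)) = k + 2 ^ z" by simp
  then show ?thesis
    using False by (metis finite_insert finite_set_decode set_encode_inverse set_insert_def)
qed (auto simp: set_insert_def)

lemma total_computable_set_insert [computability]:
  assumes "total_computable f" "total_computable g"
  shows "total_computable (\<lambda>x. set_insert (f x) (g x))"
  unfolding set_insert_def by (intro computability assms)

lemma partial_computable2_section:
  assumes "partial_computable3 f"
  shows "partial_computable2 (f i)"
proof -
  obtain u where u: "\<And>x y z. sem u [x, y, z] = f x y z"
    using assms unfolding partial_computable3_def by blast
  obtain c where c: "\<And>x. sem c [x] = Some i"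
    using total_computable_const[of i] by (meson total_computableE)
  have "sem (Comp u [Comp c [Proj 0], Proj 0, Proj 1]) [n, x] = f i n x" for n x
    by (simp add: u c)
  then show ?thesis
    unfolding partial_computable2_def by blast
qed

section \<open>Universal evaluation by enumeration of facts\<close>

text \<open>
  Argument lists and lists of codes are represented by \<open>list_encode\<close>; these are its constructor
  and selectors on codes, with arbitrary values at the code \<open>0\<close> of the empty list.
\<close>

abbreviation code_cons :: "nat \<Rightarrow> nat \<Rightarrow> nat" where
  "code_cons x xs \<equiv> Suc (pair x xs)"

abbreviation code_hd :: "nat \<Rightarrow> nat" where
  "code_hd xs \<equiv> left (xs - 1)"

abbreviation code_tl :: "nat \<Rightarrow> nat" where
  "code_tl xs \<equiv> right (xs - 1)"

fun recf_code :: "recf \<Rightarrow> nat" where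
  "recf_code Zero = pair 0 0"
| "recf_code Succ = pair 1 0"
| "recf_code (Proj i) = pair 2 i"
| "recf_code (Comp f gs) = pair 3 (pair (recf_code f) (list_encode (map recf_code gs)))"
| "recf_code (PrimRec f g) = pair 4 (pair (recf_code f) (recf_code g))"
| "recf_code (Mu f) = pair 5 (recf_code f)"

text \<open>
  Tag \<open>6\<close> is not the code of a term. It stands for the simultaneous evaluation of a list of terms,
  which reduces the composition rule to two premises.
\<close>

abbreviation recfs_code :: "recf list \<Rightarrow> nat" where
  "recfs_code gs \<equiv> pair 6 (list_encode (map recf_code gs))"

abbreviation fact_code :: "nat \<Rightarrow> nat \<Rightarrow> nat \<Rightarrow> nat" where
  "fact_code c xs y \<equiv> pair c (pair xs y)"

text \<open>
  One step of the semantics, read as rules of inference: the conclusion ``\<open>c\<close> has value \<open>y\<close> at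
  \<open>xs\<close>'' follows from premises in \<open>S\<close>. Recursive calls become membership in \<open>S\<close>, so that the
  predicate is decidable in a code of \<open>S\<close>, and intermediate results are found by a search through
  \<open>S\<close>. The disjuncts are in the order of the tags; projections and primitive
  recursions descend to the previous index, respectively to the previous recursion argument.
\<close>

definition follows :: "nat set \<Rightarrow> nat \<Rightarrow> nat \<Rightarrow> nat \<Rightarrow> bool" where
  "follows S c xs y \<longleftrightarrow>
     left c = 0 \<and> y = 0
   \<or> left c = 1 \<and> xs \<noteq> 0 \<and> code_tl xs = 0 \<and> y = Suc (code_hd xs)
   \<or> left c = 2 \<and> xs \<noteq> 0 \<and>
       (right c = 0 \<and> y = code_hd xs
        \<or> right c \<noteq> 0 \<and> fact_code (pair 2 (right c - 1)) (code_tl xs) y \<in> S)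
   \<or> left c = 3 \<and>
       (\<exists>u\<in>S. left u = pair 6 (right (right c)) \<and> left (right u) = xs
          \<and> fact_code (left (right c)) (right (right u)) y \<in> S)
   \<or> left c = 4 \<and> xs \<noteq> 0 \<and>
       (code_hd xs = 0 \<and> fact_code (left (right c)) (code_tl xs) y \<in> S
        \<or> code_hd xs \<noteq> 0 \<and>
          (\<exists>u\<in>S. left u = c \<and> left (right u) = code_cons (code_hd xs - 1) (code_tl xs)
             \<and> fact_code (right (right c))
                 (code_cons (code_hd xs - 1) (code_cons (right (right u)) (code_tl xs))) y \<in> S))
   \<or> left c = 5 \<and> fact_code (right c) (code_cons y xs) 0 \<in> S
       \<and> (\<forall>m<y. \<exists>u\<in>S. left u = right c \<and> left (right u) = code_cons m xs
              \<and> right (right u) \<noteq> 0)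
   \<or> left c = 6 \<and>
       (right c = 0 \<and> y = 0
        \<or> right c \<noteq> 0 \<and> y \<noteq> 0 \<and> fact_code (code_hd (right c)) xs (code_hd y) \<in> S
          \<and> fact_code (pair 6 (code_tl (right c))) xs (code_tl y) \<in> S)"

lemma fact_code_split: "left u = c \<Longrightarrow> left (right u) = xs \<Longrightarrow> u = fact_code c xs (right (right u))"
  by auto

text \<open>
  Nothing is required of members of \<open>S\<close> that do not concern terms or lists of terms. They may be
  derivable as well, but they are never premises of a rule whose conclusion concerns a term.
\<close>

definition sound :: "nat set \<Rightarrow> bool" where
  "sound S \<longleftrightarrow>
     (\<forall>p xs y. fact_code (recf_code p) (list_encode xs) y \<in> S \<longrightarrow> sem p xs = Some y) \<and>
     (\<forall>gs xs ys. fact_code (recfs_code gs) (list_encode xs) (list_encode ys) \<in> S \<longrightarrow>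
        map (\<lambda>g. sem g xs) gs = map Some ys)"

lemma follows_sem:
  assumes S: "sound S" and "follows S (recf_code p) (list_encode xs) y"
  shows "sem p xs = Some y"
proof (cases p)
  case Zero
  then show ?thesis using assms(2) by (simp add: follows_def)
next
  case Succ
  with assms(2) have "list_encode xs \<noteq> 0" "code_tl (list_encode xs) = 0"
    "y = Suc (code_hd (list_encode xs))"
    by (simp_all add: follows_def)
  then show ?thesis
    using Succ by (cases xs; cases "tl xs") auto
next
  case (Proj i)
  then obtain x xs' where xs: "xs = x # xs'"
    using assms(2) by (cases xs) (auto simp: follows_def)
  show ?thesis
  proof (cases i)
    case 0
    then show ?thesis using assms(2) Proj xs by (simp add: follows_def)
  next
    case (Suc j)
    then have "fact_code (recf_code (Proj j)) (list_encode xs') y \<in> S"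
      using assms(2) Proj xs by (simp add: follows_def)
    then have "sem (Proj j) xs' = Some y"
      using S unfolding sound_def by blast
    then show ?thesis using Proj Suc xs by (simp split: if_splits)
  qed
next
  case (Comp f gs)
  with assms(2) obtain u where u: "u \<in> S" "left u = recfs_code gs" "left (right u) = list_encode xs"
    and f: "fact_code (recf_code f) (right (right u)) y \<in> S"
    by (auto simp: follows_def)
  define ys where "ys = list_decode (right (right u))"
  have "fact_code (recfs_code gs) (list_encode xs) (list_encode ys) \<in> S"
    using u(1) fact_code_split[OF u(2,3)] by (simp add: ys_def)
  then have gs: "map (\<lambda>g. sem g xs) gs = map Some ys"
    using S unfolding sound_def by blast
  have "fact_code (recf_code f) (list_encode ys) y \<in> S"
    using f by (simp add: ys_def)
  then have "sem f ys = Some y"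
    using S unfolding sound_def by blast
  moreover have "\<forall>g\<in>set gs. sem g xs \<noteq> None"
    using arg_cong[OF gs, of set] by auto
  moreover have "map (\<lambda>g. the (sem g xs)) gs = ys"
    using arg_cong[OF gs, of "map the"] by (simp add: o_def)
  ultimately show ?thesis using Comp by simp
next
  case (PrimRec f g)
  then obtain n ys where xs: "xs = n # ys"
    using assms(2) by (cases xs) (auto simp: follows_def)
  show ?thesis
  proof (cases n)
    case 0
    then have "fact_code (recf_code f) (list_encode ys) y \<in> S"
      using assms(2) PrimRec xs by (simp add: follows_def)
    then have "sem f ys = Some y"
      using S unfolding sound_def by blast
    then show ?thesis using PrimRec xs 0 by simp
  next
    case (Suc m)
    then obtain u where u: "u \<in> S" "left u = recf_code p" "left (right u) = list_encode (m # ys)"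
      and g: "fact_code (recf_code g) (list_encode (m # right (right u) # ys)) y \<in> S"
      using assms(2) PrimRec xs by (auto simp: follows_def)
    have "fact_code (recf_code p) (list_encode (m # ys)) (right (right u)) \<in> S"
      using u(1) fact_code_split[OF u(2,3)] by simp
    then have "sem p (m # ys) = Some (right (right u))"
      using S unfolding sound_def by blast
    moreover have "sem g (m # right (right u) # ys) = Some y"
      using g S unfolding sound_def by blast
    ultimately show ?thesis using PrimRec xs Suc by simp
  qed
next
  case (Mu f)
  with assms(2) have zero: "fact_code (recf_code f) (list_encode (y # xs)) 0 \<in> S"
    and less: "\<forall>m<y. \<exists>u\<in>S. left u = recf_code f \<and> left (right u) = list_encode (m # xs)
                 \<and> right (right u) \<noteq> 0"
    by (simp_all add: follows_def)
  have 0: "sem f (y # xs) = Some 0"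
    using zero S unfolding sound_def by blast
  have pos: "\<exists>v. sem f (m # xs) = Some v \<and> v \<noteq> 0" if m: "m < y" for m
  proof -
    obtain u where u: "u \<in> S" "left u = recf_code f" "left (right u) = list_encode (m # xs)"
      and "right (right u) \<noteq> 0"
      using less m by blast
    moreover have "fact_code (recf_code f) (list_encode (m # xs)) (right (right u)) \<in> S"
      using u(1) fact_code_split[OF u(2,3)] by simp
    then have "sem f (m # xs) = Some (right (right u))"
      using S unfolding sound_def by blast
    ultimately show ?thesis by blast
  qed
  have "(LEAST n. sem f (n # xs) = Some 0) = y"
    using 0 pos by (intro Least_equality) (force simp: not_less[symmetric])+
  moreover have "\<exists>n. sem f (n # xs) = Some 0 \<and> (\<forall>m<n. sem f (m # xs) \<noteq> None)"
    using 0 pos by force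
  ultimately show ?thesis using Mu by simp
qed

lemma follows_map_sem:
  assumes S: "sound S" and "follows S (recfs_code gs) (list_encode xs) (list_encode ys)"
  shows "map (\<lambda>g. sem g xs) gs = map Some ys"
proof (cases gs)
  case Nil
  then show ?thesis using assms(2) by (cases ys) (simp_all add: follows_def)
next
  case (Cons g gs')
  then obtain y ys' where ys: "ys = y # ys'"
    using assms(2) by (cases ys) (auto simp: follows_def)
  have "fact_code (recf_code g) (list_encode xs) y \<in> S"
    "fact_code (recfs_code gs') (list_encode xs) (list_encode ys') \<in> S"
    using assms(2) Cons ys by (simp_all add: follows_def)
  then have "sem g xs = Some y" "map (\<lambda>g. sem g xs) gs' = map Some ys'"
    using S unfolding sound_def by blast+
  then show ?thesis using Cons ys by simp
qed

definition derivable :: "nat set \<Rightarrow> nat \<Rightarrow> bool" where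
  "derivable S z \<longleftrightarrow> follows S (left z) (left (right z)) (right (right z))"

lemma sound_insert:
  assumes S: "sound S" and z: "derivable S z"
  shows "sound (insert z S)"
  unfolding sound_def[of "insert z S"]
proof (intro conjI allI impI)
  fix p xs y assume *: "fact_code (recf_code p) (list_encode xs) y \<in> insert z S"
  show "sem p xs = Some y"
  proof (cases "fact_code (recf_code p) (list_encode xs) y \<in> S")
    case True
    then show ?thesis using S unfolding sound_def by blast
  next
    case False
    with * have "follows S (recf_code p) (list_encode xs) y"
      using z unfolding derivable_def by auto
    then show ?thesis by (rule follows_sem[OF S])
  qed
next
  fix gs xs ys
  assume *: "fact_code (recfs_code gs) (list_encode xs) (list_encode ys) \<in> insert z S"
  show "map (\<lambda>g. sem g xs) gs = map Some ys"
  proof (cases "fact_code (recfs_code gs) (list_encode xs) (list_encode ys) \<in> S")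
    case True
    then show ?thesis using S unfolding sound_def by blast
  next
    case False
    with * have "follows S (recfs_code gs) (list_encode xs) (list_encode ys)"
      using z unfolding derivable_def by auto
    then show ?thesis by (rule follows_map_sem[OF S])
  qed
qed

lemma derivable_mono: "S \<subseteq> T \<Longrightarrow> derivable S z \<Longrightarrow> derivable T z"
  unfolding derivable_def follows_def by (elim disjE) (simp_all, blast+)

lemma decidable_derivable [computability]:
  assumes "total_computable k" "total_computable z"
  shows "decidable (\<lambda>x. derivable (set_decode (k x)) (z x))"
  unfolding derivable_def follows_def
  by (intro computability assms total_computable_comp[OF assms(1)] total_computable_comp[OF assms(2)])

text \<open>
  The closure under the rules is enumerated with one candidate, \<open>left t\<close>, at step \<open>t\<close>. Every
  candidate is considered at infinitely many steps, hence at some step after all of its premises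
  have been found (\<open>known_derivable\<close>).
\<close>

fun facts :: "nat \<Rightarrow> nat" where
  "facts 0 = 0"
| "facts (Suc t) = (if derivable (set_decode (facts t)) (left t)
                    then set_insert (left t) (facts t) else facts t)"

lemma total_computable_facts [computability]:
  assumes "total_computable f"
  shows "total_computable (\<lambda>x. facts (f x))"
proof -
  have eq: "facts t = rec_nat 0 (\<lambda>t k. if derivable (set_decode k) (left t)
                                   then set_insert (left t) k else k) t" for t
    by (induction t) auto
  show ?thesis unfolding eq by (intro computability assms)
qed

lemma facts_mono: "s \<le> t \<Longrightarrow> set_decode (facts s) \<subseteq> set_decode (facts t)"
  by (induction rule: dec_induct) auto

lemma sound_facts: "sound (set_decode (facts t))"
proof (induction t)
  case 0
  show ?case by (simp add: sound_def)
qed (auto intro: sound_insert)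

definition known :: "nat set" where
  "known = (\<Union>t. set_decode (facts t))"

text \<open>
  Each rule has finitely many premises, and the sets \<open>facts t\<close> increase with \<open>t\<close>.
\<close>

lemma finite_subset_known:
  assumes "finite S" "S \<subseteq> known"
  shows "\<exists>t. S \<subseteq> set_decode (facts t)"
  using assms
proof (induction S)
  case (insert z S)
  then obtain s t where "S \<subseteq> set_decode (facts s)" "z \<in> set_decode (facts t)"
    by (auto simp: known_def)
  then show ?case
    using facts_mono[of s "max s t"] facts_mono[of t "max s t"]
    by (intro exI[of _ "max s t"]) auto
qed auto

lemma known_derivable:
  assumes "finite S" "S \<subseteq> known" "derivable S z"
  shows "z \<in> known"
proof -
  obtain t where t: "S \<subseteq> set_decode (facts t)"
    using finite_subset_known assms by blast
  \<comment> \<open>Step \<open>pair z t\<close> is not before \<open>t\<close> and considers the candidate \<open>z\<close>.\<close>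
  have "derivable (set_decode (facts (pair z t))) z"
    using derivable_mono[OF _ assms(3)] t facts_mono[OF le_prod_encode_2] by blast
  then have "z \<in> set_decode (facts (Suc (pair z t)))"
    by simp
  then show ?thesis unfolding known_def by blast
qed

lemma recfs_known:
  assumes "\<And>g. g \<in> set gs \<Longrightarrow> fact_code (recf_code g) xs (v g) \<in> known"
  shows "fact_code (recfs_code gs) xs (list_encode (map v gs)) \<in> known"
  using assms
proof (induction gs)
  case Nil
  show ?case by (rule known_derivable[of "{}"]) (auto simp: derivable_def follows_def)
next
  case (Cons g gs)
  show ?case
    by (rule known_derivable[of "{fact_code (recf_code g) xs (v g),
           fact_code (recfs_code gs) xs (list_encode (map v gs))}"])
       (use Cons in \<open>auto simp: derivable_def follows_def\<close>)
qed

lemma sem_known: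
  "sem p xs = Some y \<Longrightarrow> fact_code (recf_code p) (list_encode xs) y \<in> known"
proof (induction p arbitrary: xs y)
  case Zero
  then show ?case
    by (intro known_derivable[of "{}"]) (auto simp: derivable_def follows_def)
next
  case Succ
  then show ?case
    by (intro known_derivable[of "{}"])
       (auto simp: derivable_def follows_def split: list.splits)
next
  case (Proj i)
  then show ?case
  proof (induction i arbitrary: xs)
    case 0
    then obtain x xs' where "xs = x # xs'" by (cases xs) auto
    then show ?case using 0
      by (intro known_derivable[of "{}"]) (auto simp: derivable_def follows_def)
  next
    case (Suc i)
    then obtain x xs' where "xs = x # xs'" "sem (Proj i) xs' = Some y"
      by (cases xs) (auto split: if_splits)
    then show ?case using Suc.IH[of xs']
      by (intro known_derivable[of "{fact_code (recf_code (Proj i)) (list_encode xs') y}"])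
         (auto simp: derivable_def follows_def)
  qed
next
  case (Comp f gs)
  define ys where "ys = map (\<lambda>g. the (sem g xs)) gs"
  from Comp.prems have gs: "\<forall>g\<in>set gs. sem g xs \<noteq> None" and f: "sem f ys = Some y"
    by (auto simp: ys_def split: if_splits)
  have "fact_code (recfs_code gs) (list_encode xs) (list_encode ys) \<in> known"
    unfolding ys_def using gs by (intro recfs_known Comp.IH) auto
  moreover have "fact_code (recf_code f) (list_encode ys) y \<in> known"
    by (rule Comp.IH) (rule f)
  ultimately show ?case
    by (intro known_derivable[of "{fact_code (recfs_code gs) (list_encode xs) (list_encode ys),
          fact_code (recf_code f) (list_encode ys) y}"])
       (auto simp: derivable_def follows_def)
next
  case (PrimRec f g)
  then obtain n ys where xs: "xs = n # ys"
    by (cases xs) auto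
  have "sem (PrimRec f g) (n # ys) = Some y \<Longrightarrow>
    fact_code (recf_code (PrimRec f g)) (list_encode (n # ys)) y \<in> known"
  proof (induction n arbitrary: y)
    case 0
    then have "fact_code (recf_code f) (list_encode ys) y \<in> known"
      by (intro PrimRec.IH) simp
    then show ?case
      by (intro known_derivable[of "{fact_code (recf_code f) (list_encode ys) y}"])
         (auto simp: derivable_def follows_def)
  next
    case (Suc n)
    then obtain v where v: "sem (PrimRec f g) (n # ys) = Some v" "sem g (n # v # ys) = Some y"
      by (auto split: option.splits)
    have "fact_code (recf_code g) (list_encode (n # v # ys)) y \<in> known"
      by (rule PrimRec.IH) (rule v)
    then show ?case using Suc.IH[OF v(1)]
      by (intro known_derivable[of "{fact_code (recf_code (PrimRec f g)) (list_encode (n # ys)) v,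
            fact_code (recf_code g) (list_encode (n # v # ys)) y}"])
         (auto simp: derivable_def follows_def)
  qed
  then show ?case using PrimRec.prems xs by blast
next
  case (Mu f)
  then obtain n where n: "sem f (n # xs) = Some 0" "\<forall>m<n. sem f (m # xs) \<noteq> None"
    and y: "y = (LEAST n. sem f (n # xs) = Some 0)"
    by (auto split: if_splits)
  have "y \<le> n" unfolding y by (rule Least_le) (rule n)
  have zero: "sem f (y # xs) = Some 0" unfolding y by (rule LeastI) (rule n)
  have "\<exists>v. sem f (m # xs) = Some v \<and> v \<noteq> 0" if "m < y" for m
    using n(2) \<open>y \<le> n\<close> that not_less_Least[of m "\<lambda>n. sem f (n # xs) = Some 0"] unfolding y[symmetric]
    by (metis less_le_trans not_None_eq)
  then obtain v where v: "\<And>m. m < y \<Longrightarrow> sem f (m # xs) = Some (v m) \<and> v m \<noteq> 0"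
    by metis
  let ?S = "insert (fact_code (recf_code f) (list_encode (y # xs)) 0)
              ((\<lambda>m. fact_code (recf_code f) (list_encode (m # xs)) (v m)) ` {..<y})"
  have "?S \<subseteq> known"
    using zero v Mu.IH by blast
  moreover have "derivable ?S (fact_code (recf_code (Mu f)) (list_encode xs) y)"
    using v by (auto simp: derivable_def follows_def)
  ultimately show ?case by (intro known_derivable[of ?S]) auto
qed

text \<open>
  The universal evaluation: convergence of an arbitrary term is the appearance of a fact, and
  \<open>t\<close> plays the role of the number of computation steps.
\<close>

lemma facts_iff_sem:
  "(\<exists>t. fact_code (recf_code p) (list_encode xs) y \<in> set_decode (facts t)) \<longleftrightarrow> sem p xs = Some y"
  using sound_facts sem_known unfolding sound_def known_def by blast

section \<open>Tables of witnesses and targets\<close>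

text \<open>
  The use of strong density: infinitely many members of \<open>A\<close> extend the finite function \<open>G\<close>. Each
  has an index, so the indices of such members are unbounded.
\<close>

lemma late_extension:
  fixes \<mu> :: "nat \<Rightarrow> nat \<rightharpoonup> nat"
  assumes A: "range \<mu> = A" and dense: "strongly_dense_in A A"
    and G: "finite G" "\<And>x y. (x, y) \<in> G \<Longrightarrow> \<mu> w x = Some y"
  shows "\<exists>q\<ge>b. \<forall>(x, y)\<in>G. \<mu> q x = Some y"
proof -
  define \<sigma> where "\<sigma> = \<mu> w |` (fst ` G)"
  have "finite (dom \<sigma>)" "\<sigma> \<subseteq>\<^sub>m \<mu> w"
    using G(1) by (auto simp: \<sigma>_def map_le_def)
  then have "infinite {g \<in> A. \<sigma> \<subseteq>\<^sub>m g}"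
    using dense A unfolding strongly_dense_in_def by blast
  moreover have "{g \<in> A. \<sigma> \<subseteq>\<^sub>m g} = \<mu> ` {q. \<sigma> \<subseteq>\<^sub>m \<mu> q}"
    using A by auto
  ultimately have "infinite {q. \<sigma> \<subseteq>\<^sub>m \<mu> q}"
    by (metis finite_imageI)
  then have "\<exists>q\<ge>b. q \<in> {q. \<sigma> \<subseteq>\<^sub>m \<mu> q}"
    by (simp only: infinite_nat_iff_unbounded_le)
  then obtain q where q: "q \<ge> b" "\<sigma> \<subseteq>\<^sub>m \<mu> q"
    by blast
  have "\<mu> q x = Some y" if "(x, y) \<in> G" for x y
  proof -
    have "\<sigma> x = Some y"
      using G(2) that by (force simp: \<sigma>_def restrict_map_def)
    then show ?thesis
      using q(2) unfolding map_le_def by (metis domI)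
  qed
  with q(1) show ?thesis by blast
qed

definition converges :: "nat \<Rightarrow> nat \<Rightarrow> nat \<Rightarrow> bool" where
  "converges s e n \<longleftrightarrow>
     (\<exists>u\<in>set_decode (facts s). left u = e \<and> left (right u) = code_cons n 0)"

lemma decidable_converges [computability]:
  assumes "total_computable s" "total_computable e" "total_computable n"
  shows "decidable (\<lambda>x. converges (s x) (e x) (n x))"
  unfolding converges_def
  by (intro computability assms assms[THEN total_computable_comp])

lemma converges_iff:
  "converges s e n \<longleftrightarrow> (\<exists>v. fact_code e (list_encode [n]) v \<in> set_decode (facts s))"
proof
  assume "converges s e n"
  then obtain u where u: "u \<in> set_decode (facts s)" "left u = e" "left (right u) = list_encode [n]"
    by (auto simp: converges_def)
  then show "\<exists>v. fact_code e (list_encode [n]) v \<in> set_decode (facts s)"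
    using fact_code_split[OF u(2,3)] by metis
qed (force simp: converges_def)

text \<open>
  A finite table is the code of a finite set of pairs \<open>\<langle>c, n\<rangle>\<close>, \<open>n\<close> being the entry in cell \<open>c\<close>. As
  all entries are below the code \<open>h\<close> of the table, a value of at least \<open>h\<close> signals an empty cell.
\<close>

definition lookup :: "nat \<Rightarrow> nat \<Rightarrow> nat" where
  "lookup h c = (LEAST n. pair c n \<in> set_decode h \<or> h \<le> n)"

lemma total_computable_lookup [computability]:
  assumes "total_computable h" "total_computable c"
  shows "total_computable (\<lambda>x. lookup (h x) (c x))"
  unfolding lookup_def
  by (intro computability assms assms[THEN total_computable_comp]) auto

lemma entry_less: "pair c n \<in> set_decode h \<Longrightarrow> n < h"
  using le_prod_encode_2 mem_set_decode_less le_less_trans by blast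

lemma pair_lookup:
  assumes "lookup h c < h"
  shows "pair c (lookup h c) \<in> set_decode h"
proof -
  have "pair c (lookup h c) \<in> set_decode h \<or> h \<le> lookup h c"
    unfolding lookup_def by (rule LeastI[of _ h]) simp
  with assms show ?thesis by simp
qed

lemma lookup_less_iff: "lookup h c < h \<longleftrightarrow> (\<exists>n. pair c n \<in> set_decode h)"
proof
  assume "\<exists>n. pair c n \<in> set_decode h"
  then obtain n where n: "pair c n \<in> set_decode h" ..
  then have "lookup h c \<le> n"
    unfolding lookup_def by (intro Least_le) simp
  then show "lookup h c < h" using entry_less[OF n] by simp
qed (use pair_lookup in blast)

text \<open>
  Cell \<open>\<langle>i, e, 0\<rangle>\<close> holds the witness at which \<open>\<phi> e\<close> is prevented from reducing numbering \<open>i\<close>,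
  and cell \<open>\<langle>i, e, 1\<rangle>\<close> holds the target with which that witness is swapped. Cells with another
  last component are never filled.
\<close>

abbreviation cell :: "nat \<Rightarrow> nat \<Rightarrow> nat \<Rightarrow> nat" where
  "cell i e k \<equiv> pair i (pair e k)"

text \<open>
  Two numbers are swapped as soon as they are the witness and the target of one pair \<open>(i, e)\<close>, in
  either order. The bound on \<open>k\<close> makes \<open>1 - k\<close> an exchange of the two cells.
\<close>

definition swaps :: "nat \<Rightarrow> nat \<Rightarrow> nat \<Rightarrow> nat \<Rightarrow> bool" where
  "swaps h i n n' \<longleftrightarrow>
     (\<exists>e k. k \<le> 1 \<and> pair (cell i e k) n \<in> set_decode h
        \<and> pair (cell i e (1 - k)) n' \<in> set_decode h)"

lemma decidable_swaps [computability]: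
  assumes "total_computable h" "total_computable i" "total_computable n" "total_computable n'"
  shows "decidable (\<lambda>x. swaps (h x) (i x) (n x) (n' x))"
proof -
  have eq: "swaps h i n n' \<longleftrightarrow>
     (\<exists>u\<in>set_decode h. left (left u) = i \<and> right (right (left u)) \<le> 1 \<and> right u = n
        \<and> pair (cell i (left (right (left u))) (1 - right (right (left u)))) n' \<in> set_decode h)"
    for h i n n'
    unfolding swaps_def
    by (rule iffI) (force, metis pair_left_right)
  show ?thesis
    unfolding eq
    by (intro computability assms assms[THEN total_computable_comp])
qed

lemma swaps_sym: "swaps h i n n' \<Longrightarrow> swaps h i n' n"
  unfolding swaps_def by (metis diff_diff_cancel diff_le_self)

lemma swaps_mono: "swaps h i n n' \<Longrightarrow> set_decode h \<subseteq> set_decode h' \<Longrightarrow> swaps h' i n n'"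
  unfolding swaps_def by blast

lemma swaps_less: "swaps h i n n' \<Longrightarrow> n' < h"
  unfolding swaps_def using entry_less by blast

section \<open>The construction\<close>

locale dense_friedberg =
  fixes A :: "(nat \<rightharpoonup> nat) set" and \<mu> :: "nat \<Rightarrow> nat \<rightharpoonup> nat" and p :: recf
  assumes sem_p: "sem p [n, x] = \<mu> n x"
    and inj_\<mu>: "inj \<mu>"
    and range_\<mu>: "range \<mu> = A"
    and dense: "strongly_dense_in A A"
begin

definition graph_at :: "nat \<Rightarrow> nat \<Rightarrow> nat \<Rightarrow> nat \<Rightarrow> bool" where
  "graph_at t n x y \<longleftrightarrow>
     fact_code (recf_code p) (code_cons n (code_cons x 0)) y \<in> set_decode (facts t)"

lemma decidable_graph_at [computability]:
  assumes "total_computable t" "total_computable n" "total_computable x" "total_computable y"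
  shows "decidable (\<lambda>z. graph_at (t z) (n z) (x z) (y z))"
  unfolding graph_at_def by (intro computability assms)

lemma graph_at_iff: "(\<exists>t. graph_at t n x y) \<longleftrightarrow> \<mu> n x = Some y"
  using facts_iff_sem[of p "[n, x]" y] by (simp add: graph_at_def sem_p)

lemma graph_at_mono: "graph_at s n x y \<Longrightarrow> s \<le> t \<Longrightarrow> graph_at t n x y"
  unfolding graph_at_def using facts_mono by blast

lemma graph_at_less:
  assumes "graph_at t n x y"
  shows "x < facts t" "y < facts t"
proof -
  have z: "fact_code (recf_code p) (code_cons n (code_cons x 0)) y < facts t"
    using assms mem_set_decode_less unfolding graph_at_def by blast
  have "x \<le> code_cons x 0"
    by (simp add: le_SucI le_prod_encode_1)
  also have "\<dots> \<le> code_cons n (code_cons x 0)"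
    by (simp only: le_SucI le_prod_encode_2)
  also have "\<dots> \<le> pair (code_cons n (code_cons x 0)) y"
    by (rule le_prod_encode_1)
  also have "\<dots> \<le> fact_code (recf_code p) (code_cons n (code_cons x 0)) y"
    by (rule le_prod_encode_2)
  finally show "x < facts t" using z by simp
  have "y \<le> pair (code_cons n (code_cons x 0)) y"
    by (rule le_prod_encode_2)
  also have "\<dots> \<le> fact_code (recf_code p) (code_cons n (code_cons x 0)) y"
    by (rule le_prod_encode_2)
  finally show "y < facts t" using z by simp
qed

text \<open>
  Step \<open>t\<close> confirms that \<open>\<mu> q\<close> extends the part of \<open>\<mu> w\<close> that is known at step \<open>s\<close>. The bounds lose
  nothing, by \<open>graph_at_less\<close>.
\<close>

definition extends_at :: "nat \<Rightarrow> nat \<Rightarrow> nat \<Rightarrow> nat \<Rightarrow> bool" where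
  "extends_at s w t q \<longleftrightarrow>
     (\<forall>x<facts s. \<forall>y<facts s. graph_at s w x y \<longrightarrow> graph_at t q x y)"

lemma decidable_extends_at [computability]:
  assumes "total_computable s" "total_computable w" "total_computable t" "total_computable q"
  shows "decidable (\<lambda>z. extends_at (s z) (w z) (t z) (q z))"
  unfolding extends_at_def
  by (intro computability assms assms[THEN total_computable_comp]
      assms[THEN total_computable_comp, THEN total_computable_comp])

text \<open>
  The search for a target never fails: an index of an extension exists by density, and the finitely
  many values to be confirmed all appear by some common step.
\<close>

lemma ex_extends_at: "\<exists>c. b \<le> left c \<and> extends_at s w (right c) (left c)"
proof -
  define G where "G = {(x, y). graph_at s w x y}"
  have "G \<subseteq> {..<facts s} \<times> {..<facts s}"
    using graph_at_less by (auto simp: G_def)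
  then have "finite G"
    by (rule finite_subset) simp
  moreover have "\<mu> w x = Some y" if "(x, y) \<in> G" for x y
    using that graph_at_iff by (auto simp: G_def)
  ultimately obtain q where q: "q \<ge> b" and ext: "\<forall>(x, y)\<in>G. \<mu> q x = Some y"
    using late_extension[OF range_\<mu> dense] by blast
  then have "\<forall>z\<in>G. \<exists>t. graph_at t q (fst z) (snd z)"
    using graph_at_iff by fastforce
  then obtain t where t: "\<And>z. z \<in> G \<Longrightarrow> graph_at (t z) q (fst z) (snd z)"
    by metis
  have "graph_at (Max (t ` G)) q x y" if "graph_at s w x y" for x y
  proof -
    have "(x, y) \<in> G" using that by (simp add: G_def)
    moreover from this have "t (x, y) \<le> Max (t ` G)"
      using \<open>finite G\<close> by simp
    ultimately show ?thesis
      using t graph_at_mono by fastforce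
  qed
  then show ?thesis
    using q by (intro exI[of _ "pair q (Max (t ` G))"]) (simp add: extends_at_def)
qed

definition extension :: "nat \<Rightarrow> nat \<Rightarrow> nat \<Rightarrow> nat" where
  "extension s w b = left (LEAST c. b \<le> left c \<and> extends_at s w (right c) (left c))"

lemma total_computable_extension [computability]:
  assumes "total_computable s" "total_computable w" "total_computable b"
  shows "total_computable (\<lambda>z. extension (s z) (w z) (b z))"
  unfolding extension_def
  by (intro computability assms assms[THEN total_computable_comp] ex_extends_at)

lemma
  shows extension_ge: "b \<le> extension s w b"
    and extension_extends: "graph_at s w x y \<Longrightarrow> \<mu> (extension s w b) x = Some y"
proof -
  have *: "b \<le> extension s w b \<and> (\<exists>t. extends_at s w t (extension s w b))"
    unfolding extension_def using LeastI_ex[OF ex_extends_at] by blast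
  then show "b \<le> extension s w b" ..
  show "\<mu> (extension s w b) x = Some y" if "graph_at s w x y"
    using * that graph_at_less[OF that] graph_at_iff unfolding extends_at_def by blast
qed

text \<open>
  Stage \<open>s\<close> attends to cell \<open>left s\<close>, so every cell receives attention at infinitely many stages. An
  empty witness cell is filled with a fresh number. An empty target cell is filled once its witness
  is reserved and its computation has converged. New entries are at least \<open>h\<close>, hence larger than all
  earlier entries. They are also at least \<open>s\<close>, so that a number below \<open>s\<close> that is not yet an entry
  never becomes one. A target is moreover at least \<open>facts s\<close> and thereby larger than the value that
  the computation has returned.
\<close>

definition next_stage :: "nat \<Rightarrow> nat \<Rightarrow> nat" where
  "next_stage s h =
     (if lookup h (left s) < h then h
      else if right (right (left s)) = 0 then set_insert (pair (left s) (h + s)) h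
      else if right (right (left s)) = 1
        \<and> lookup h (cell (left (left s)) (left (right (left s))) 0) < h
        \<and> converges s (left (right (left s)))
             (lookup h (cell (left (left s)) (left (right (left s))) 0))
      then set_insert (pair (left s)
             (extension s (lookup h (cell (left (left s)) (left (right (left s))) 0))
               (h + facts s + s))) h
      else h)"

fun stage :: "nat \<Rightarrow> nat" where
  "stage 0 = 0"
| "stage (Suc s) = next_stage s (stage s)"

lemma total_computable_stage [computability]:
  assumes "total_computable f"
  shows "total_computable (\<lambda>x. stage (f x))"
proof -
  have eq: "stage t = rec_nat 0 next_stage t" for t
    by (induction t) auto
  show ?thesis unfolding eq next_stage_def by (intro computability assms)
qed

lemma stage_mono: "s \<le> t \<Longrightarrow> set_decode (stage s) \<subseteq> set_decode (stage t)"
  by (induction rule: dec_induct) (auto simp: next_stage_def)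

text \<open>
  All that is used of a stage: it adds at most one entry, the cell was empty, the entry is fresh, and
  a target continues what is known about its witness.
\<close>

lemma new_entry:
  assumes "z \<in> set_decode (stage (Suc s))" "z \<notin> set_decode (stage s)"
  obtains i e k n where "z = pair (cell i e k) n"
    "set_decode (stage (Suc s)) = insert z (set_decode (stage s))"
    "stage s + s \<le> n"
    "\<And>n'. pair (cell i e k) n' \<notin> set_decode (stage s)"
    "k = 0 \<or> k = 1 \<and> (\<exists>w. pair (cell i e 0) w \<in> set_decode (stage s)
       \<and> converges s e w \<and> facts s \<le> n \<and> (\<forall>x y. graph_at s w x y \<longrightarrow> \<mu> n x = Some y))"
proof -
  define h i e k where "h = stage s" and "i = left (left s)" and "e = left (right (left s))"
    and "k = right (right (left s))"
  have c: "left s = cell i e k" by (simp add: i_def e_def k_def)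
  define w where "w = lookup h (cell i e 0)"
  have z: "z \<in> set_decode (next_stage s h)" "z \<notin> set_decode h"
    using assms by (simp_all add: h_def)
  have free: "\<not> lookup h (cell i e k) < h"
    using z by (auto simp: next_stage_def c)
  then have free': "\<And>n'. pair (cell i e k) n' \<notin> set_decode h"
    unfolding lookup_less_iff by blast
  have "\<exists>n. z = pair (cell i e k) n
      \<and> set_decode (next_stage s h) = insert z (set_decode h) \<and> h + s \<le> n
      \<and> (k = 0 \<or> k = 1 \<and> w < h \<and> converges s e w \<and> facts s \<le> n
           \<and> n = extension s w (h + facts s + s))"
  proof (cases "k = 0")
    case True
    then show ?thesis
      using z free by (intro exI[of _ "h + s"]) (simp add: next_stage_def c)
  next
    case False
    then show ?thesis
      using z free extension_ge[of "h + facts s + s" s w]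
      by (intro exI[of _ "extension s w (h + facts s + s)"])
        (auto simp: next_stage_def c w_def split: if_splits)
  qed
  then obtain n where n: "z = pair (cell i e k) n"
      "set_decode (next_stage s h) = insert z (set_decode h)" "h + s \<le> n"
      "k = 0 \<or> k = 1 \<and> w < h \<and> converges s e w \<and> facts s \<le> n
           \<and> n = extension s w (h + facts s + s)"
    by blast
  have "\<exists>w. pair (cell i e 0) w \<in> set_decode h \<and> converges s e w \<and> facts s \<le> n
      \<and> (\<forall>x y. graph_at s w x y \<longrightarrow> \<mu> n x = Some y)" if "k \<noteq> 0"
  proof (intro exI conjI allI impI)
    show "pair (cell i e 0) w \<in> set_decode h"
      unfolding w_def by (rule pair_lookup) (use n(4) that in \<open>simp add: w_def\<close>)
    show "converges s e w" "facts s \<le> n"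
      using n(4) that by blast+
    show "\<mu> n x = Some y" if "graph_at s w x y" for x y
      using n(4) \<open>k \<noteq> 0\<close> extension_extends[OF that] by blast
  qed
  then have "k = 0 \<or> k = 1 \<and> (\<exists>w. pair (cell i e 0) w \<in> set_decode h \<and> converges s e w
      \<and> facts s \<le> n \<and> (\<forall>x y. graph_at s w x y \<longrightarrow> \<mu> n x = Some y))"
    using n(4) by blast
  with n(1-3) free' show thesis
    unfolding h_def by (intro that[of i e k n]) simp_all
qed

lemma entry_inj_stage:
  "pair c n \<in> set_decode (stage t) \<Longrightarrow> pair c' n' \<in> set_decode (stage t) \<Longrightarrow> c = c' \<longleftrightarrow> n = n'"
proof (induction t arbitrary: c n c' n')
  case (Suc t)
  have fresh: "c\<^sub>1 \<noteq> c\<^sub>2 \<and> n\<^sub>1 \<noteq> n\<^sub>2"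
    if new: "pair c\<^sub>1 n\<^sub>1 \<in> set_decode (stage (Suc t))" "pair c\<^sub>1 n\<^sub>1 \<notin> set_decode (stage t)"
      and old: "pair c\<^sub>2 n\<^sub>2 \<in> set_decode (stage t)" for c\<^sub>1 n\<^sub>1 c\<^sub>2 n\<^sub>2
    using new_entry[OF new] old entry_less[OF old] by (metis Pair_inject add_leE leD prod_encode_eq)
  have single: "z = z'"
    if "z \<in> set_decode (stage (Suc t))" "z \<notin> set_decode (stage t)"
      "z' \<in> set_decode (stage (Suc t))" "z' \<notin> set_decode (stage t)" for z z'
    using new_entry[OF that(1,2)] that(3,4) by (metis insertE)
  show ?case
    using Suc.IH[of c n c' n'] fresh[of c n c' n'] fresh[of c' n' c n]
      single[of "pair c n" "pair c' n'"] Suc.prems by (metis Pair_inject prod_encode_eq)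
qed simp

text \<open>
  The table of all stages is injective in both directions, because every new entry is larger than all
  earlier ones and goes to an empty cell.
\<close>

lemma entry_inj:
  assumes "pair c n \<in> set_decode (stage s)" "pair c' n' \<in> set_decode (stage t)"
  shows "c = c' \<longleftrightarrow> n = n'"
  using assms stage_mono[of s "max s t"] stage_mono[of t "max s t"]
  by (intro entry_inj_stage[of _ _ "max s t"]) auto

lemma target_origin:
  "pair (cell i e 1) q \<in> set_decode (stage t) \<Longrightarrow>
    \<exists>w s. pair (cell i e 0) w \<in> set_decode (stage t) \<and> converges s e w \<and> facts s \<le> q"
proof (induction t)
  case (Suc t)
  have "\<exists>w s. pair (cell i e 0) w \<in> set_decode (stage t) \<and> converges s e w \<and> facts s \<le> q"
  proof (cases "pair (cell i e 1) q \<in> set_decode (stage t)")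
    case False
    then show ?thesis
      by (rule new_entry[OF Suc.prems]) auto
  qed (rule Suc.IH)
  then show ?case
    using stage_mono[of t "Suc t"] by (meson le_SucI order_refl subsetD)
qed simp

lemma swaps_unique:
  assumes "swaps (stage s) i n n'" "swaps (stage t) i n n''"
  shows "n' = n''"
proof -
  obtain e k where 1: "k \<le> 1" "pair (cell i e k) n \<in> set_decode (stage s)"
      "pair (cell i e (1 - k)) n' \<in> set_decode (stage s)"
    using assms(1) unfolding swaps_def by blast
  obtain e' k' where 2: "k' \<le> 1" "pair (cell i e' k') n \<in> set_decode (stage t)"
      "pair (cell i e' (1 - k')) n'' \<in> set_decode (stage t)"
    using assms(2) unfolding swaps_def by blast
  have "cell i e k = cell i e' k'" using entry_inj[OF 1(2) 2(2)] by simp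
  then have "cell i e (1 - k) = cell i e' (1 - k')" by simp
  then show ?thesis using entry_inj[OF 1(3) 2(3)] by blast
qed

lemma swaps_same_numbering:
  assumes "pair (cell i e k) n \<in> set_decode (stage s)" "swaps (stage t) i' n n'"
  shows "i' = i"
  using assms(2) entry_inj[OF assms(1)] unfolding swaps_def by fastforce

text \<open>
  The choice is only from a singleton, by \<open>swaps_unique\<close>.
\<close>

definition perm :: "nat \<Rightarrow> nat \<Rightarrow> nat" where
  "perm i n = (if \<exists>t n'. swaps (stage t) i n n' then SOME n'. \<exists>t. swaps (stage t) i n n' else n)"

lemma perm_swaps:
  assumes "swaps (stage t) i n n'"
  shows "perm i n = n'"
proof -
  have "\<exists>s. swaps (stage s) i n (SOME n'. \<exists>t. swaps (stage t) i n n')"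
    by (rule someI_ex[of "\<lambda>n'. \<exists>t. swaps (stage t) i n n'"]) (use assms in blast)
  then have "(SOME n'. \<exists>t. swaps (stage t) i n n') = n'"
    using assms swaps_unique by blast
  then show ?thesis
    using assms by (auto simp: perm_def)
qed

lemma perm_fixed: "(\<And>t n'. \<not> swaps (stage t) i n n') \<Longrightarrow> perm i n = n"
  by (simp add: perm_def)

lemma perm_perm: "perm i (perm i n) = n"
proof (cases "\<exists>t n'. swaps (stage t) i n n'")
  case True
  then show ?thesis using perm_swaps swaps_sym by metis
next
  case False
  then show ?thesis by (simp add: perm_fixed)
qed

section \<open>The rearranged numberings\<close>

text \<open>
  A number that is still in place at a stage \<open>t > n\<close> can only be moved later as a witness, since
  targets chosen from then on are at least \<open>t\<close>. The function that it is moved to agrees with all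
  values of \<open>\<mu> n\<close> known at stage \<open>t\<close>; so these values may be announced at once.
\<close>

lemma late_swap_extends:
  assumes "n < t" and unswapped: "\<And>n'. \<not> swaps (stage t) i n n'" and "graph_at t n x y"
  shows "\<mu> (perm i n) x = Some y"
proof (cases "\<exists>s n'. swaps (stage s) i n n'")
  case False
  then show ?thesis
    using assms(3) graph_at_iff[of n x y] by (auto simp: perm_fixed)
next
  case True
  \<comment> \<open>The swap is completed at the step from \<open>r\<close> to \<open>Suc r\<close>, which adds only one of the two entries.\<close>
  define s where "s = (LEAST s. \<exists>n'. swaps (stage s) i n n')"
  have "\<exists>n'. swaps (stage s) i n n'"
    unfolding s_def using True by (rule LeastI_ex)
  then obtain n' where n': "swaps (stage s) i n n'" ..
  have "t < s"
    using n' unswapped swaps_mono[OF n' stage_mono[of s t]] by (meson not_le)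
  then obtain r where r: "s = Suc r" "t \<le> r"
    by (cases s) auto
  have not_r: "\<not> swaps (stage r) i n n'"
    using not_less_Least[of r "\<lambda>s. \<exists>n'. swaps (stage s) i n n'"] r(1) unfolding s_def[symmetric] by auto
  obtain e k where k: "k \<le> 1" and ent: "pair (cell i e k) n \<in> set_decode (stage (Suc r))"
      "pair (cell i e (1 - k)) n' \<in> set_decode (stage (Suc r))"
    using n' unfolding swaps_def r(1) by blast
  \<comment> \<open>A new entry would be at least \<open>r\<close>, but \<open>n < t \<le> r\<close>.\<close>
  have old: "pair (cell i e k) n \<in> set_decode (stage r)"
  proof (rule ccontr)
    assume "pair (cell i e k) n \<notin> set_decode (stage r)"
    then have "r \<le> n" by (rule new_entry[OF ent(1)]) auto
    then show False using \<open>n < t\<close> r(2) by simp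
  qed
  then have new: "pair (cell i e (1 - k)) n' \<notin> set_decode (stage r)"
    using not_r k unfolding swaps_def by blast
  have *: "\<And>m. pair (cell i e (1 - k)) m \<notin> set_decode (stage r)"
      "1 - k = 0 \<or> (\<exists>w. pair (cell i e 0) w \<in> set_decode (stage r)
         \<and> (\<forall>x y. graph_at r w x y \<longrightarrow> \<mu> n' x = Some y))"
    by (rule new_entry[OF ent(2) new]; force)+
  \<comment> \<open>Otherwise \<open>n\<close> is a target whose witness was reserved only afterwards.\<close>
  have "k = 0"
  proof (rule ccontr)
    assume "k \<noteq> 0"
    then have "k = 1" using k by simp
    then show False
      using *(1) target_origin old by (metis diff_self_eq_0)
  qed
  then obtain w where w: "pair (cell i e 0) w \<in> set_decode (stage r)"
      "\<forall>x y. graph_at r w x y \<longrightarrow> \<mu> n' x = Some y"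
    using *(2) by auto
  have "w = n"
    using entry_inj[OF w(1) old] \<open>k = 0\<close> by simp
  then show ?thesis
    using w(2) graph_at_mono[OF assms(3) r(2)] perm_swaps[OF n'] by simp
qed

definition \<nu> :: "nat \<Rightarrow> nat \<Rightarrow> nat \<rightharpoonup> nat" where
  "\<nu> i n = \<mu> (perm i n)"

text \<open>
  The value of \<open>\<nu> i n\<close> at \<open>x\<close> can be announced at stage \<open>t\<close>: either \<open>n\<close> has found its final
  partner, or \<open>\<mu> n x\<close> has converged while \<open>n\<close> was in place. The condition \<open>n < t\<close> ensures that \<open>n\<close>
  does not become a target later.
\<close>

definition decided :: "nat \<Rightarrow> nat \<Rightarrow> nat \<Rightarrow> nat \<Rightarrow> bool" where
  "decided i n x t \<longleftrightarrow>
     n < t \<and> ((\<exists>n'<stage t. swaps (stage t) i n n') \<or> (\<exists>y<facts t. graph_at t n x y))"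

text \<open>
  Stage \<open>t\<close> of the limit \<open>perm i n\<close>. The case distinction keeps the search total: as long as \<open>n\<close>
  has no partner, it stops at \<open>n\<close> itself.
\<close>

definition perm_at :: "nat \<Rightarrow> nat \<Rightarrow> nat \<Rightarrow> nat" where
  "perm_at t i n =
     (LEAST m. if \<exists>n'<stage t. swaps (stage t) i n n' then swaps (stage t) i n m else m = n)"

lemma total_computable_perm_at [computability]:
  assumes "total_computable t" "total_computable i" "total_computable n"
  shows "total_computable (\<lambda>x. perm_at (t x) (i x) (n x))"
  unfolding perm_at_def
  by (intro computability assms assms[THEN total_computable_comp]
      assms[THEN total_computable_comp, THEN total_computable_comp]) auto

lemma decidable_decided:
  "decidable (\<lambda>z. decided (left (left z)) (left (right (left z))) (right (right (left z))) (right z))"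
  unfolding decided_def by (intro computability)

lemma perm_at_swaps:
  assumes "swaps (stage t) i n n'"
  shows "perm_at t i n = n'"
proof -
  have "\<exists>n'<stage t. swaps (stage t) i n n'"
    using assms swaps_less by blast
  then have "perm_at t i n = (LEAST m. swaps (stage t) i n m)"
    unfolding perm_at_def by (simp only: if_True)
  also have "\<dots> = n'"
  proof (rule Least_equality)
    show "n' \<le> m" if "swaps (stage t) i n m" for m
      using swaps_unique[OF assms that] by (rule eq_refl)
  qed (rule assms)
  finally show ?thesis .
qed

lemma perm_at_fixed:
  assumes "\<And>n'. \<not> swaps (stage t) i n n'"
  shows "perm_at t i n = n"
proof -
  have "perm_at t i n = (LEAST m. m = n)"
    unfolding perm_at_def using assms by (simp only: simp_thms if_False)
  also have "\<dots> = n"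
    by (rule Least_equality) simp_all
  finally show ?thesis .
qed

lemma decided_correct:
  assumes "decided i n x t"
  shows "\<mu> (perm_at t i n) x = \<nu> i n x"
proof (cases "\<exists>n'. swaps (stage t) i n n'")
  case True
  then obtain n' where n': "swaps (stage t) i n n'" ..
  show ?thesis
    by (simp add: \<nu>_def perm_at_swaps[OF n'] perm_swaps[OF n'])
next
  case False
  then have unswapped: "\<And>n'. \<not> swaps (stage t) i n n'"
    by simp
  then obtain y where "n < t" and y: "graph_at t n x y"
    using assms unfolding decided_def by blast
  have "\<mu> n x = Some y"
    using y graph_at_iff[of n x y] by blast
  moreover have "\<mu> (perm i n) x = Some y"
    by (rule late_swap_extends[OF \<open>n < t\<close> unswapped y])
  ultimately show ?thesis
    by (simp add: \<nu>_def perm_at_fixed[OF unswapped])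
qed

text \<open>
  Where \<open>\<nu> i n\<close> is undefined the search for a deciding stage may well succeed; the subsequent
  evaluation of \<open>\<mu>\<close> then diverges.
\<close>

lemma decided_if_defined:
  assumes "\<nu> i n x = Some y"
  shows "\<exists>t. decided i n x t"
proof (cases "\<exists>t n'. swaps (stage t) i n n'")
  case True
  then obtain t n' where n': "swaps (stage t) i n n'" by blast
  have "swaps (stage (max t (Suc n))) i n n'"
    by (rule swaps_mono[OF n' stage_mono]) simp
  then have "\<exists>n'<stage (max t (Suc n)). swaps (stage (max t (Suc n))) i n n'"
    using swaps_less by meson
  then have "decided i n x (max t (Suc n))"
    unfolding decided_def by simp
  then show ?thesis ..
next
  case False
  then have "\<mu> n x = Some y"
    using assms by (simp add: \<nu>_def perm_fixed)
  then obtain t where "graph_at t n x y"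
    using graph_at_iff[of n x y] by blast
  then have "graph_at (max t (Suc n)) n x y"
    by (rule graph_at_mono) simp
  then have "\<exists>y<facts (max t (Suc n)). graph_at (max t (Suc n)) n x y"
    using graph_at_less(2) by meson
  then have "decided i n x (max t (Suc n))"
    unfolding decided_def by simp
  then show ?thesis ..
qed

text \<open>
  Search for a deciding stage \<open>t\<close> and then run the program of \<open>\<mu>\<close> at \<open>perm_at t i n\<close>. If no stage
  is deciding, the value is undefined, by \<open>decided_if_defined\<close>.
\<close>

lemma uniformly_ce_\<nu>: "uniformly_ce \<nu>"
proof -
  obtain q where q: "\<And>z. sem q [z] =
      (if \<exists>t. decided (left z) (left (right z)) (right (right z)) t
       then Some (LEAST t. decided (left z) (left (right z)) (right (right z)) t) else None)"
    using partial_Least[of "\<lambda>z. decided (left z) (left (right z)) (right (right z))",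
        OF decidable_decided] by metis
  have "total_computable (\<lambda>z. perm_at (right z) (left (left z)) (left (right (left z))))"
    by (intro computability)
  then obtain r where r: "\<And>z. sem r [z] = Some (perm_at (right z) (left (left z)) (left (right (left z))))"
    by (meson total_computableE)
  define v where "v = Comp pair_recf [Proj 0, Comp pair_recf [Proj 1, Proj 2]]"
  define u where "u = Comp p [Comp r [Comp pair_recf [v, Comp q [v]]], Proj 2]"
  have v: "sem v [i, n, x] = Some (pair i (pair n x))" for i n x
    by (simp add: v_def)
  have "sem u [i, n, x] = \<nu> i n x" for i n x
  proof (cases "\<exists>t. decided i n x t")
    case True
    then have "sem u [i, n, x] = \<mu> (perm_at (LEAST t. decided i n x t) i n) x"
      by (simp add: u_def v q r sem_p)
    also have "\<dots> = \<nu> i n x"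
      by (rule decided_correct[OF LeastI_ex[OF True]])
    finally show ?thesis .
  next
    case False
    then have "sem u [i, n, x] = None"
      by (simp add: u_def v q)
    then show ?thesis
      using False decided_if_defined by (metis option.exhaust)
  qed
  then show ?thesis
    unfolding uniformly_ce_def partial_computable3_def by blast
qed

lemma friedberg_numbering_\<nu>: "friedberg_numbering (\<nu> i) A"
proof -
  have \<nu>: "\<nu> i = \<mu> \<circ> perm i"
    by (simp add: fun_eq_iff \<nu>_def)
  have "bij (perm i)"
    by (rule o_bij[of "perm i"]) (simp_all add: fun_eq_iff perm_perm)
  then have "inj (\<nu> i)"
    unfolding \<nu> by (intro inj_compose inj_\<mu> bij_is_inj)
  moreover have "range (\<nu> i) = A"
    unfolding \<nu> image_comp[symmetric] bij_is_surj[OF \<open>bij (perm i)\<close>] by (rule range_\<mu>)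
  moreover have "partial_computable2 (\<nu> i)"
    using uniformly_ce_\<nu> unfolding uniformly_ce_def by (rule partial_computable2_section)
  ultimately show ?thesis
    unfolding friedberg_numbering_def computable_numbering_def numbering_def by blast
qed

section \<open>Independence\<close>

lemma next_stage_witness:
  assumes "left s = cell i e 0"
  shows "\<exists>w. pair (cell i e 0) w \<in> set_decode (next_stage s h)"
  using pair_lookup[of h "cell i e 0"] by (auto simp: next_stage_def assms)

lemma next_stage_target:
  assumes "left s = cell i e 1" "lookup h (cell i e 0) = w" "w < h" "converges s e w"
  shows "\<exists>q. pair (cell i e 1) q \<in> set_decode (next_stage s h)"
  using pair_lookup[of h "cell i e 1"] assms by (auto simp: next_stage_def)

lemma witness_exists: "\<exists>s w. pair (cell i e 0) w \<in> set_decode (stage s)"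
proof -
  have "left (pair (cell i e 0) 0) = cell i e 0"
    by simp
  from next_stage_witness[OF this, of "stage (pair (cell i e 0) 0)"] show ?thesis
    unfolding stage.simps(2)[symmetric] by blast
qed

text \<open>
  The target cell is attended to at a stage late enough for both the witness and the computation.
\<close>

lemma target_exists:
  assumes w: "pair (cell i e 0) w \<in> set_decode (stage s\<^sub>0)" and conv: "converges t e w"
  shows "\<exists>s q. pair (cell i e 1) q \<in> set_decode (stage s)"
proof -
  \<comment> \<open>The pairing is at least its second argument, so this stage is late enough.\<close>
  define s where "s = pair (cell i e 1) (max s\<^sub>0 t)"
  have "max s\<^sub>0 t \<le> s"
    unfolding s_def by (rule le_prod_encode_2)
  then have le: "s\<^sub>0 \<le> s" "t \<le> s"
    by simp_all
  have ws: "pair (cell i e 0) w \<in> set_decode (stage s)"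
    using w stage_mono[OF le(1)] by blast
  then have l: "lookup (stage s) (cell i e 0) < stage s"
    unfolding lookup_less_iff by blast
  have lw: "lookup (stage s) (cell i e 0) = w"
    using entry_inj_stage[OF pair_lookup[OF l] ws] by simp
  have "converges s e w"
    using conv facts_mono[OF le(2)] unfolding converges_iff by blast
  moreover have "left s = cell i e 1"
    by (simp add: s_def)
  ultimately have "\<exists>q. pair (cell i e 1) q \<in> set_decode (next_stage s (stage s))"
    using next_stage_target[OF _ lw] l unfolding lw by blast
  then show ?thesis
    unfolding stage.simps(2)[symmetric] by blast
qed

text \<open>
  The converging computation is a member of \<open>facts s\<close> for the stage \<open>s\<close> at which the target was
  chosen, so its value is below \<open>facts s\<close>, which in turn is at most the target.
\<close>

lemma target_exceeds_value:
  assumes w: "pair (cell i (recf_code r) 0) w \<in> set_decode (stage s)"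
    and q: "pair (cell i (recf_code r) 1) q \<in> set_decode (stage t)"
    and v: "sem r [w] = Some v"
  shows "v < q"
proof -
  obtain w' s' where w': "pair (cell i (recf_code r) 0) w' \<in> set_decode (stage t)"
    and conv: "converges s' (recf_code r) w'" and le: "facts s' \<le> q"
    using target_origin[OF q] by blast
  have "w' = w"
    using entry_inj[OF w' w] by simp
  then obtain v' where v': "fact_code (recf_code r) (list_encode [w]) v' \<in> set_decode (facts s')"
    using conv unfolding converges_iff by blast
  then have "sem r [w] = Some v'"
    using facts_iff_sem[of r "[w]" v'] by metis
  then have "v' = v"
    using v by simp
  have "v' \<le> pair (list_encode [w]) v'"
    by (rule le_prod_encode_2)
  also have "\<dots> < facts s'"
    using v' by (rule entry_less)
  finally show ?thesis
    using le \<open>v' = v\<close> by simp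
qed

text \<open>
  The diagonal argument. A reduction of \<open>\<nu> i\<close> would have to send the witness to a number \<open>m\<close> with
  \<open>perm j' m = q\<close>, where \<open>q\<close> is the target. As \<open>perm j'\<close> is an involution and does not move \<open>q\<close>,
  this forces \<open>m = q\<close>, but \<open>m\<close> is bounded by the value of the reduction at the witness.
\<close>

lemma independent_\<nu>: "independent_numberings \<nu>"
  unfolding independent_numberings_def
proof (intro allI notI)
  fix i
  assume "reducible (\<nu> i) (direct_sum (omit i \<nu>))"
  then obtain f where "total_computable f" and f: "\<nu> i = direct_sum (omit i \<nu>) \<circ> f"
    unfolding reducible_def by blast
  then obtain r where r: "\<And>x. sem r [x] = Some (f x)"
    by (meson total_computableE)
  obtain s w where w: "pair (cell i (recf_code r) 0) w \<in> set_decode (stage s)"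
    using witness_exists by blast
  obtain t where "fact_code (recf_code r) (list_encode [w]) (f w) \<in> set_decode (facts t)"
    using r[of w] facts_iff_sem[of r "[w]" "f w"] by blast
  then have "converges t (recf_code r) w"
    unfolding converges_iff by blast
  then obtain s' q where q: "pair (cell i (recf_code r) 1) q \<in> set_decode (stage s')"
    using target_exists[OF w] by blast
  have "swaps (stage (max s s')) i w q"
    unfolding swaps_def using w q stage_mono[of s "max s s'"] stage_mono[of s' "max s s'"]
    by (intro exI[of _ "recf_code r"] exI[of _ 0]) auto
  then have "\<nu> i w = \<mu> q"
    using perm_swaps by (simp add: \<nu>_def)
  define j m where "j = left (f w)" and "m = right (f w)"
  define j' where "j' = (if j < i then j else Suc j)"
  have "j' \<noteq> i" by (simp add: j'_def)
  have "\<nu> i w = \<nu> j' m"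
    unfolding f o_apply direct_sum_def omit_def j'_def j_def m_def
    by (simp only: case_prod_beta if_distrib[of \<nu>] if_distribR)
  then have "q = perm j' m"
    using \<open>\<nu> i w = \<mu> q\<close> injD[OF inj_\<mu>] unfolding \<nu>_def[of j' m] by metis
  \<comment> \<open>Every entry of the table belongs to a single numbering, and that of \<open>q\<close> is \<open>i\<close>.\<close>
  moreover have "perm j' q = q"
    using swaps_same_numbering[OF q] \<open>j' \<noteq> i\<close> by (intro perm_fixed) blast
  ultimately have "q = m"
    using perm_perm[of j' m] by simp
  then show False
    using target_exceeds_value[OF w q r] right_le[of "f w"] by (simp add: m_def)
qed

end

theorem corollary12:
  fixes A :: "(nat \<rightharpoonup> nat) set"
  assumes "A \<subseteq> P1"
    and "\<exists>\<mu>. friedberg_numbering \<mu> A"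
    and "strongly_dense_in A A"
  shows "\<exists>\<nu> :: nat \<Rightarrow> nat \<Rightarrow> nat \<rightharpoonup> nat.
    (\<forall>i. friedberg_numbering (\<nu> i) A) \<and> uniformly_ce \<nu> \<and> independent_numberings \<nu>"
proof -
  obtain \<mu> p where "range \<mu> = A" "inj \<mu>" "\<And>n x. sem p [n, x] = \<mu> n x"
    using assms(2)
    by (auto simp: friedberg_numbering_def computable_numbering_def numbering_def
        partial_computable2_def)
  then interpret dense_friedberg A \<mu> p
    using assms(3) by unfold_locales
  show ?thesis
    using friedberg_numbering_\<nu> uniformly_ce_\<nu> independent_\<nu> by blast
qed

end
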